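(* Let $\mathcal{A}$ be an algebra over a field $F$ which is either a Novikov algebra or a bicommutative algebra. Then $\mathcal{A}$ is Lie nilpotent if and only if $\mathcal{A}$ is of finite class. Consequently, the ideal of $\mathcal{A}$ generated by $\{ab-ba\mid a,b\in\mathcal{A}\}$ is nilpotent if $\mathcal{A}$ is Lie nilpotent.
   Context: An algebra over a field $F$ is an $F$-vector space with a bilinear multiplication (not necessarily associative or unital); "ideal" means two-sided ideal. A (left) Novikov algebra is an algebra satisfying $(xy)z=(xz)y$ (right commutativity) and $(xy)z-x(yz)=(yx)z-y(xz)$ (left symmetry) for all $x,y,z$. A bicommutative algebra is an algebra satisfying $x(yz)=y(xz)$ (left commutativity) and $(xy)z=(xz)y$ (right commutativity) for all $x,y,z$. Write $[a,b]=ab-ba$. For subspaces $A,B$ of $\mathcal{A}$, $[A,B]$ is the linear span of all $[a,b]$ with $a\in A$, $b\in B$; $AB$ is the linear span of all $ab$ with $a\in A$, $b\in B$; and $A\circ B$ is the ideal of $\mathcal{A}$ generated by $[A,B]$. Define $\mathcal{A}_{[1]}=\mathcal{A}$ and $\mathcal{A}_{[i+1]}=[\mathcal{A},\mathcal{A}_{[i]}]$ for $i\ge 1$; $\mathcal{A}$ is Lie nilpotent if $\mathcal{A}_{[i]}=(0)$ for some integer $i\geq 1$. Define $H_1=\mathcal{A}$ and $H_{i+1}=H_i\circ\mathcal{A}$ for $i\ge 1$; $\mathcal{A}$ is of finite class if $H_n=(0)$ for some positive integer $n$. For a subspace $V$ of $\mathcal{A}$, put $V^1=V$ and $V^n=\sum_{1\le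 i\le n-1}V^iV^{n-i}$ for $n\ge 2$; $V$ is nilpotent if $V^n=(0)$ for some positive integer $n$. *)

theory Defs
  imports Complex_Main
begin

text \<open>
  The underlying vector space is the whole type \<^typ>\<open>'a\<close>, so the algebra itself, viewed as a subspace,
  is \<^const>\<open>UNIV\<close>. The multiplication is an explicit parameter because the type classes for
  multiplication on a ring all assume associativity.
\<close>

locale nonassoc_algebra = vector_space scale
  for scale :: "'f::field \<Rightarrow> 'a::ab_group_add \<Rightarrow> 'a" (infixr \<open>*s\<close> 75) +
  fixes mult :: "'a \<Rightarrow> 'a \<Rightarrow> 'a" (infixl \<open>\<cdot>\<close> 70)
  assumes mult_add_left: "(x + y) \<cdot> z = x \<cdot> z + y \<cdot> z"
    and mult_add_right: "x \<cdot> (y + z) = x \<cdot> y + x \<cdot> z"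
    and mult_scale_left: "(c *s x) \<cdot> y = c *s (x \<cdot> y)"
    and mult_scale_right: "x \<cdot> (c *s y) = c *s (x \<cdot> y)"
begin

definition commutator :: "'a \<Rightarrow> 'a \<Rightarrow> 'a"
  where "commutator a b = a \<cdot> b - b \<cdot> a"

definition commutator_space :: "'a set \<Rightarrow> 'a set \<Rightarrow> 'a set"
  where "commutator_space A B = span {commutator a b | a b. a \<in> A \<and> b \<in> B}"

definition product_space :: "'a set \<Rightarrow> 'a set \<Rightarrow> 'a set"
  where "product_space A B = span {a \<cdot> b | a b. a \<in> A \<and> b \<in> B}"

definition two_sided_ideal :: "'a set \<Rightarrow> bool"
  where "two_sided_ideal I \<longleftrightarrow> subspace I \<and> (\<forall>x\<in>I. \<forall>a. a \<cdot> x \<in> I \<and> x \<cdot> a \<in> I)"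

definition ideal_generated :: "'a set \<Rightarrow> 'a set"
  where "ideal_generated S = two_sided_ideal hull S"

definition circ :: "'a set \<Rightarrow> 'a set \<Rightarrow> 'a set"
  where "circ A B = ideal_generated (commutator_space A B)"

text \<open>
  The three sequences below are indexed from 1; the value at index 0 is a convention and is never used.
\<close>

fun lie_power :: "nat \<Rightarrow> 'a set"
  where
    "lie_power 0 = UNIV"
  | "lie_power (Suc 0) = UNIV"
  | "lie_power (Suc (Suc i)) = commutator_space UNIV (lie_power (Suc i))"

definition lie_nilpotent :: bool
  where "lie_nilpotent \<longleftrightarrow> (\<exists>i\<ge>1. lie_power i = {0})"

fun H_series :: "nat \<Rightarrow> 'a set"
  where
    "H_series 0 = UNIV"
  | "H_series (Suc 0) = UNIV"
  | "H_series (Suc (Suc i)) = circ (H_series (Suc i)) UNIV"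

definition finite_class :: bool
  where "finite_class \<longleftrightarrow> (\<exists>n\<ge>1. H_series n = {0})"

text \<open>
  A sum of finitely many subspaces is rendered as the span of their union.
\<close>

fun subspace_power :: "'a set \<Rightarrow> nat \<Rightarrow> 'a set"
  where
    "subspace_power V 0 = V"
  | "subspace_power V (Suc 0) = V"
  | "subspace_power V (Suc (Suc m)) =
       span (\<Union>i\<in>{1..Suc m}.
         product_space (subspace_power V i) (subspace_power V (Suc (Suc m) - i)))"

definition nilpotent_subspace :: "'a set \<Rightarrow> bool"
  where "nilpotent_subspace V \<longleftrightarrow> (\<exists>n\<ge>1. subspace_power V n = {0})"

end

locale novikov_algebra = nonassoc_algebra +
  assumes right_commutative: "(x \<cdot> y) \<cdot> z = (x \<cdot> z) \<cdot> y"
    and left_symmetric: "(x \<cdot> y) \<cdot> z - x \<cdot> (y \<cdot> z) = (y \<cdot> x) \<cdot> z - y \<cdot> (x \<cdot> z)"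

locale bicommutative_algebra = nonassoc_algebra +
  assumes left_commutative: "x \<cdot> (y \<cdot> z) = y \<cdot> (x \<cdot> z)"
    and right_commutative: "(x \<cdot> y) \<cdot> z = (x \<cdot> z) \<cdot> y"

end

theory Submission
  imports Defs
begin

text \<open>
  Call \<open>z\<close> central modulo an ideal \<open>J\<close> if all commutators \<open>[z, a]\<close> lie in \<open>J\<close>. The theorem rests on one
  fact, which Novikov and bicommutative algebras share: if \<open>z\<close> is central modulo \<open>J\<close>, then the
  associators \<open>(z, a, b)\<close> and \<open>(a, z, b)\<close> lie in \<open>J\<close>. Indeed both associators can be written
  out in terms of commutators of \<open>z\<close>; for instance, \<open>(a, z, b) = [z, a] b - [z, a b]\<close> in a Novikov algebra.
  Together with right commutativity this has two consequences.

  First, the elements that are central modulo an ideal form an ideal. So the upper central series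
  \<open>0 = U\<^sub>0 \<subseteq> U\<^sub>1 \<subseteq> \<dots>\<close> of the commutator bracket, where \<open>U\<^sub>k\<^sub>+\<^sub>1\<close> consists of the elements that are central
  modulo \<open>U\<^sub>k\<close>, is a series of ideals. Lie nilpotency means, as for Lie algebras, that some \<open>U\<^sub>m\<close>
  is the whole algebra. The series \<open>H\<^sub>1, H\<^sub>2, \<dots>\<close> is the fastest descending series of ideals with
  \<open>[H\<^sub>i, \<A>] \<subseteq> H\<^sub>i\<^sub>+\<^sub>1\<close>, so it descends below the ideals \<open>U\<^sub>m, U\<^sub>m\<^sub>-\<^sub>1, \<dots>\<close> and reaches zero. Conversely,
  the Lie powers lie below the \<open>H\<^sub>i\<close> in every algebra.

  Second, elements that are central modulo \<open>J\<close> annihilate all commutators modulo \<open>J\<close>, and then also the ideal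
  \<open>I\<close> generated by the commutators. So multiplication by \<open>I\<close>, on either side, moves \<open>U\<^sub>k\<^sub>+\<^sub>1\<close> into \<open>U\<^sub>k\<close>.
  A nonassociative product of \<open>2\<^sup>k\<^sup>+\<^sup>1\<close> factors from \<open>I\<close> has a top-level factor with at least \<open>2\<^sup>k\<close>
  of them, hence by induction products of \<open>2\<^sup>k\<close> factors lie in \<open>U\<^sub>m\<^sub>-\<^sub>k\<close>, and \<open>I\<close> is nilpotent.
\<close>

section \<open>Ideals and the upper central series\<close>

context nonassoc_algebra
begin

lemma mult_diff_left: "(x - y) \<cdot> z = x \<cdot> z - y \<cdot> z"
  using mult_add_left[of "x - y" y z] by (simp add: algebra_simps)

lemma mult_diff_right: "x \<cdot> (y - z) = x \<cdot> y - x \<cdot> z"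
  using mult_add_right[of x "y - z" z] by (simp add: algebra_simps)

lemma mult_zero_left: "0 \<cdot> x = 0"
  using mult_diff_left[of 0 0 x] by simp

lemma mult_zero_right: "x \<cdot> 0 = 0"
  using mult_diff_right[of x 0 0] by simp

lemmas mult_linear = mult_add_left mult_add_right mult_diff_left mult_diff_right
  mult_scale_left mult_scale_right

lemma ideal_subspace: "two_sided_ideal J \<Longrightarrow> subspace J"
  by (simp add: two_sided_ideal_def)

lemma ideal_mult_left: "two_sided_ideal J \<Longrightarrow> x \<in> J \<Longrightarrow> a \<cdot> x \<in> J"
  by (simp add: two_sided_ideal_def)

lemma ideal_mult_right: "two_sided_ideal J \<Longrightarrow> x \<in> J \<Longrightarrow> x \<cdot> a \<in> J"
  by (simp add: two_sided_ideal_def)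

lemma two_sided_ideal_zero: "two_sided_ideal {0}"
  by (simp add: two_sided_ideal_def subspace_def mult_zero_left mult_zero_right)

lemma two_sided_ideal_UNIV: "two_sided_ideal UNIV"
  by (simp add: two_sided_ideal_def)

lemma two_sided_ideal_ideal_generated: "two_sided_ideal (ideal_generated S)"
  unfolding ideal_generated_def hull_def two_sided_ideal_def subspace_def by blast

lemma subset_ideal_generated: "S \<subseteq> ideal_generated S"
  unfolding ideal_generated_def by (rule hull_subset)

lemma ideal_generated_minimal:
  "S \<subseteq> J \<Longrightarrow> two_sided_ideal J \<Longrightarrow> ideal_generated S \<subseteq> J"
  unfolding ideal_generated_def by (rule hull_minimal)

lemma two_sided_ideal_H_series: "two_sided_ideal (H_series i)"
  by (cases i rule: H_series.cases)
    (simp_all add: two_sided_ideal_UNIV circ_def two_sided_ideal_ideal_generated)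

lemma subspace_lie_power: "subspace (lie_power i)"
  by (cases i rule: lie_power.cases) (simp_all add: commutator_space_def)

lemma commutator_swap: "commutator a b = - commutator b a"
  by (simp add: commutator_def)

lemma lie_power_subset_H_series: "lie_power i \<subseteq> H_series i"
proof (induction i rule: lie_power.induct)
  case (3 i)
  have "commutator a b \<in> H_series (Suc (Suc i))" if "b \<in> lie_power (Suc i)" for a b
  proof -
    have "b \<in> H_series (Suc i)"
      using 3 that by blast
    then have "commutator b a \<in> commutator_space (H_series (Suc i)) UNIV"
      unfolding commutator_space_def by (intro span_base) blast
    then have "commutator b a \<in> H_series (Suc (Suc i))"
      using subset_ideal_generated by (auto simp: circ_def)
    then show ?thesis
      using commutator_swap[of a b] ideal_subspace[OF two_sided_ideal_H_series] subspace_neg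
      by metis
  qed
  then show ?case
    unfolding lie_power.simps commutator_space_def
    by (intro span_minimal ideal_subspace[OF two_sided_ideal_H_series]) blast
qed simp_all

theorem finite_class_imp_lie_nilpotent:
  assumes finite_class
  shows lie_nilpotent
proof -
  from assms obtain n where "n \<ge> 1" "H_series n = {0}"
    unfolding finite_class_def by blast
  with lie_power_subset_H_series[of n] subspace_0[OF subspace_lie_power[of n]]
  have "lie_power n = {0}" by blast
  with \<open>n \<ge> 1\<close> show ?thesis
    unfolding lie_nilpotent_def by blast
qed

definition central_modulo :: "'a set \<Rightarrow> 'a set"
  where "central_modulo J = {z. \<forall>a. commutator z a \<in> J}"

primrec upper_central :: "nat \<Rightarrow> 'a set"
  where
    "upper_central 0 = {0}"
  | "upper_central (Suc k) = central_modulo (upper_central k)"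

lemma central_moduloD: "z \<in> central_modulo J \<Longrightarrow> commutator z a \<in> J"
  by (simp add: central_modulo_def)

lemma subspace_central_modulo:
  assumes "subspace J"
  shows "subspace (central_modulo J)"
proof -
  have "commutator 0 a = 0" "commutator (x + y) a = commutator x a + commutator y a"
    "commutator (c *s x) a = c *s commutator x a" for a x y c
    by (simp_all add: commutator_def mult_linear mult_zero_left mult_zero_right
        scale_right_diff_distrib)
  then show ?thesis
    using assms by (auto simp: subspace_def central_modulo_def)
qed

text \<open>
  The usual comparison of the lower and the upper central series of a Lie algebra: each step down the
  lower series is matched by a step down the upper one.
\<close>

lemma lie_power_subset_upper_central:
  assumes "lie_power (Suc n) = {0}" "k \<le> n"
  shows "lie_power (Suc n - k) \<subseteq> upper_central k"
  using assms(2)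
proof (induction k)
  case 0
  then show ?case by (simp add: assms(1))
next
  case (Suc k)
  show ?case
  proof
    fix z assume z: "z \<in> lie_power (Suc n - Suc k)"
    define j where "j = n - Suc k"
    then have j: "Suc n - k = Suc (Suc j)" "Suc n - Suc k = Suc j"
      using Suc.prems by simp_all
    have "commutator z a \<in> upper_central k" for a
    proof -
      have "commutator a z \<in> lie_power (Suc (Suc j))"
        using z unfolding j lie_power.simps commutator_space_def by (intro span_base) blast
      then have "- commutator a z \<in> lie_power (Suc n - k)"
        unfolding j by (rule subspace_neg[OF subspace_lie_power])
      with Suc show ?thesis
        using commutator_swap[of z a] by auto
    qed
    then show "z \<in> upper_central (Suc k)"
      by (simp add: central_modulo_def)
  qed
qed

lemma lie_nilpotent_imp_upper_central_UNIV:
  assumes lie_nilpotent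
  obtains m where "upper_central m = UNIV"
proof -
  from assms obtain n where "lie_power (Suc n) = {0}"
    unfolding lie_nilpotent_def by (auto dest: Suc_le_D)
  from lie_power_subset_upper_central[OF this, of n] have "upper_central n = UNIV"
    by auto
  then show thesis by (rule that)
qed

end

section \<open>Algebras whose relatively central elements are nuclear\<close>

text \<open>
  The common ground of the two varieties. The last two assumptions say that, in the quotient by
  any ideal, central elements lie in the left and in the middle nucleus. They are stated relative to an
  ideal so that they apply to every step of the upper central series without forming quotients.
\<close>

locale central_nuclear_algebra = nonassoc_algebra +
  assumes mult_right_commute: "(x \<cdot> y) \<cdot> z = (x \<cdot> z) \<cdot> y"
    and central_left_nuclear:
      "two_sided_ideal J \<Longrightarrow> z \<in> central_modulo J \<Longrightarrow> (z \<cdot> a) \<cdot> b - z \<cdot> (a \<cdot> b) \<in> J"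
    and central_middle_nuclear:
      "two_sided_ideal J \<Longrightarrow> z \<in> central_modulo J \<Longrightarrow> (a \<cdot> z) \<cdot> b - a \<cdot> (z \<cdot> b) \<in> J"
begin

text \<open>
  Modulo \<open>J\<close>, middle nuclearity and right commutativity give \<open>b (z a) = (b z) a = (z b) a = (z a) b\<close> for
  central \<open>z\<close>, so \<open>z a\<close> is again central.
\<close>

lemma two_sided_ideal_central_modulo:
  assumes J: "two_sided_ideal J"
  shows "two_sided_ideal (central_modulo J)"
proof -
  have sub: "subspace J"
    using J by (rule ideal_subspace)
  have right: "z \<cdot> a \<in> central_modulo J" if z: "z \<in> central_modulo J" for z a
  proof -
    have "commutator (z \<cdot> a) b \<in> J" for b
    proof -
      have "commutator z b \<cdot> a + ((b \<cdot> z) \<cdot> a - b \<cdot> (z \<cdot> a)) \<in> J"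
        by (intro subspace_add[OF sub] ideal_mult_right[OF J] central_moduloD[OF z]
            central_middle_nuclear[OF J z])
      also have "commutator z b \<cdot> a + ((b \<cdot> z) \<cdot> a - b \<cdot> (z \<cdot> a)) = commutator (z \<cdot> a) b"
        by (simp add: commutator_def mult_linear mult_right_commute[of z a b])
      finally show ?thesis .
    qed
    then show ?thesis
      by (simp add: central_modulo_def)
  qed
  have left: "a \<cdot> z \<in> central_modulo J" if z: "z \<in> central_modulo J" for z a
  proof -
    have "commutator (a \<cdot> z) b \<in> J" for b
    proof -
      let ?c = "commutator z a"
      have "?c \<in> J"
        using z by (rule central_moduloD)
      then have "commutator (z \<cdot> a) b - (?c \<cdot> b - b \<cdot> ?c) \<in> J"
        by (intro subspace_diff[OF sub] ideal_mult_right[OF J] ideal_mult_left[OF J]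
            central_moduloD[OF right[OF z]])
      also have "commutator (z \<cdot> a) b - (?c \<cdot> b - b \<cdot> ?c) = commutator (a \<cdot> z) b"
        by (simp add: commutator_def mult_linear)
      finally show ?thesis .
    qed
    then show ?thesis
      by (simp add: central_modulo_def)
  qed
  show ?thesis
    using subspace_central_modulo[OF sub] left right by (simp add: two_sided_ideal_def)
qed

lemma two_sided_ideal_upper_central: "two_sided_ideal (upper_central k)"
  by (induction k) (simp_all add: two_sided_ideal_zero two_sided_ideal_central_modulo)

lemma H_series_subset_upper_central:
  assumes "upper_central m = UNIV" "i \<le> m"
  shows "H_series (Suc i) \<subseteq> upper_central (m - i)"
  using assms(2)
proof (induction i)
  case 0
  then show ?case by (simp add: assms(1))
next
  case (Suc i)
  have "commutator z a \<in> upper_central (m - Suc i)" if "z \<in> H_series (Suc i)" for z a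
  proof -
    have "m - i = Suc (m - Suc i)"
      using Suc.prems by simp
    with Suc that have "z \<in> central_modulo (upper_central (m - Suc i))"
      by auto
    then show ?thesis by (rule central_moduloD)
  qed
  then have "commutator_space (H_series (Suc i)) UNIV \<subseteq> upper_central (m - Suc i)"
    unfolding commutator_space_def
    by (intro span_minimal ideal_subspace[OF two_sided_ideal_upper_central]) blast
  then show ?case
    by (simp add: circ_def ideal_generated_minimal two_sided_ideal_upper_central)
qed

theorem lie_nilpotent_imp_finite_class:
  assumes lie_nilpotent
  shows finite_class
proof -
  from assms obtain m where "upper_central m = UNIV"
    by (rule lie_nilpotent_imp_upper_central_UNIV)
  from H_series_subset_upper_central[OF this, of m]
  have "H_series (Suc m) \<subseteq> {0}" by simp
  moreover have "0 \<in> H_series (Suc m)"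
    by (rule subspace_0[OF ideal_subspace[OF two_sided_ideal_H_series]])
  ultimately have "H_series (Suc m) = {0}" by blast
  then show ?thesis
    unfolding finite_class_def by (intro exI[of _ "Suc m"]) simp
qed

section \<open>Nilpotency of the commutator ideal\<close>

abbreviation "commutator_ideal \<equiv> ideal_generated {a \<cdot> b - b \<cdot> a | a b. True}"

text \<open>
  For \<open>z\<close> central modulo \<open>J\<close>, left nuclearity and right commutativity give
  \<open>z (a b) = (z a) b = (z b) a = z (b a)\<close> modulo \<open>J\<close>. The elements annihilated in this way by all relatively
  central \<open>z\<close> form an ideal because \<open>z (w a) = (z w) a\<close> and \<open>z (a w) = (z a) w\<close> modulo \<open>J\<close>, where
  \<open>z a\<close> is again central.
\<close>

lemma central_mult_commutator_ideal:
  assumes J: "two_sided_ideal J" and "z \<in> central_modulo J" "w \<in> commutator_ideal"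
  shows "z \<cdot> w \<in> J"
proof -
  have sub: "subspace J"
    using J by (rule ideal_subspace)
  define N where "N = {w. \<forall>z\<in>central_modulo J. z \<cdot> w \<in> J}"
  have "subspace N"
    using sub by (auto simp: N_def subspace_def mult_linear mult_zero_right)
  moreover have "w \<cdot> a \<in> N \<and> a \<cdot> w \<in> N" if w: "w \<in> N" for w a
  proof -
    have "z \<cdot> (w \<cdot> a) \<in> J" "z \<cdot> (a \<cdot> w) \<in> J" if z: "z \<in> central_modulo J" for z
    proof -
      have "z \<cdot> w \<in> J"
        using w z by (simp add: N_def)
      then have "(z \<cdot> w) \<cdot> a \<in> J"
        by (rule ideal_mult_right[OF J])
      then have "(z \<cdot> w) \<cdot> a - ((z \<cdot> w) \<cdot> a - z \<cdot> (w \<cdot> a)) \<in> J"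
        by (intro subspace_diff[OF sub] central_left_nuclear[OF J z])
      then show "z \<cdot> (w \<cdot> a) \<in> J" by simp
      have "(z \<cdot> a) \<cdot> w \<in> J"
        using w ideal_mult_right[OF two_sided_ideal_central_modulo[OF J] z] by (simp add: N_def)
      then have "(z \<cdot> a) \<cdot> w - ((z \<cdot> a) \<cdot> w - z \<cdot> (a \<cdot> w)) \<in> J"
        by (intro subspace_diff[OF sub] central_left_nuclear[OF J z])
      then show "z \<cdot> (a \<cdot> w) \<in> J" by simp
    qed
    then show ?thesis by (simp add: N_def)
  qed
  ultimately have "two_sided_ideal N"
    by (simp add: two_sided_ideal_def)
  moreover have "a \<cdot> b - b \<cdot> a \<in> N" for a b
  proof -
    have "z \<cdot> (a \<cdot> b - b \<cdot> a) \<in> J" if z: "z \<in> central_modulo J" for z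
    proof -
      have "((z \<cdot> b) \<cdot> a - z \<cdot> (b \<cdot> a)) - ((z \<cdot> a) \<cdot> b - z \<cdot> (a \<cdot> b)) \<in> J"
        by (intro subspace_diff[OF sub] central_left_nuclear[OF J z])
      then show ?thesis
        by (simp add: mult_linear mult_right_commute[of z b a])
    qed
    then show ?thesis by (simp add: N_def)
  qed
  ultimately have "commutator_ideal \<subseteq> N"
    by (intro ideal_generated_minimal) auto
  with assms show ?thesis
    by (auto simp: N_def)
qed

lemma commutator_ideal_mult_central:
  assumes J: "two_sided_ideal J" and z: "z \<in> central_modulo J" and w: "w \<in> commutator_ideal"
  shows "w \<cdot> z \<in> J"
proof -
  have "z \<cdot> w - commutator z w \<in> J"
    by (intro subspace_diff[OF ideal_subspace[OF J]] central_mult_commutator_ideal[OF J z w]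
        central_moduloD[OF z])
  then show ?thesis by (simp add: commutator_def)
qed

lemma subspace_power_subset_ideal:
  assumes "two_sided_ideal J"
  shows "subspace_power J i \<subseteq> J"
proof (induction i rule: less_induct)
  case (less i)
  show ?case
  proof (cases i rule: H_series.cases)
    case (3 m)
    have "a \<cdot> b \<in> J" if "j \<in> {1..Suc m}" "a \<in> subspace_power J j" for a b j
      using less[of j] that 3 by (intro ideal_mult_right[OF assms]) auto
    then show ?thesis
      unfolding 3 subspace_power.simps product_space_def
      by (intro span_minimal ideal_subspace[OF assms] UN_least) blast
  qed simp_all
qed

text \<open>
  In a product of at least \<open>2 \<cdot> 2\<^sup>k\<close> factors one of the two top-level factors consists of
  at least \<open>2\<^sup>k\<close> of them, and the other one still lies in the commutator ideal.
\<close>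

lemma commutator_ideal_power_subset_upper_central:
  assumes "upper_central m = UNIV" "k \<le> m" "2 ^ k \<le> i"
  shows "subspace_power commutator_ideal i \<subseteq> upper_central (m - k)"
  using assms(2,3)
proof (induction k arbitrary: i)
  case 0
  then show ?case by (simp add: assms(1))
next
  case (Suc k)
  let ?I = "commutator_ideal" and ?U = "upper_central (m - Suc k)"
  have U: "upper_central (m - k) = central_modulo ?U"
    using Suc.prems(1) upper_central.simps(2)[of "m - Suc k"] by (simp add: Suc_diff_Suc)
  have "2 \<le> i"
    using Suc.prems(2) by (rule order_trans[rotated]) simp
  then obtain n where i: "i = Suc (Suc n)"
    by (metis add_2_eq_Suc le_Suc_ex)
  have "a \<cdot> b \<in> ?U"
    if j: "j \<in> {1..Suc n}" and a: "a \<in> subspace_power ?I j" and b: "b \<in> subspace_power ?I (i - j)"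
    for a b j
  proof -
    have "a \<in> ?I" "b \<in> ?I"
      using a b subspace_power_subset_ideal[OF two_sided_ideal_ideal_generated] by blast+
    consider "2 ^ k \<le> j" | "2 ^ k \<le> i - j"
      using Suc.prems(2) by fastforce
    then show ?thesis
    proof cases
      case 1
      then have "a \<in> central_modulo ?U"
        using Suc.IH[of j] Suc.prems(1) a U by auto
      then show ?thesis
        using \<open>b \<in> ?I\<close> by (rule central_mult_commutator_ideal[OF two_sided_ideal_upper_central])
    next
      case 2
      then have "b \<in> central_modulo ?U"
        using Suc.IH[of "i - j"] Suc.prems(1) b U by auto
      then show ?thesis
        using \<open>a \<in> ?I\<close> by (rule commutator_ideal_mult_central[OF two_sided_ideal_upper_central])
    qed
  qed
  then show ?case
    unfolding i subspace_power.simps product_space_def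
    by (intro span_minimal ideal_subspace[OF two_sided_ideal_upper_central] UN_least) blast
qed

theorem lie_nilpotent_imp_commutator_ideal_nilpotent:
  assumes lie_nilpotent
  shows "nilpotent_subspace commutator_ideal"
proof -
  from assms obtain m where "upper_central m = UNIV"
    by (rule lie_nilpotent_imp_upper_central_UNIV)
  from commutator_ideal_power_subset_upper_central[OF this, of m "2 ^ Suc m"]
  have sub: "subspace_power commutator_ideal (2 ^ Suc m) \<subseteq> {0}"
    by simp
  have "(2::nat) \<le> 2 ^ Suc m"
    by simp
  then obtain n where n: "2 ^ Suc m = Suc (Suc n)"
    by (metis add_2_eq_Suc le_Suc_ex)
  have "0 \<in> subspace_power commutator_ideal (2 ^ Suc m)"
    unfolding n by (simp add: span_zero)
  with sub have "subspace_power commutator_ideal (2 ^ Suc m) = {0}"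
    by blast
  then show ?thesis
    unfolding nilpotent_subspace_def by (intro exI[of _ "2 ^ Suc m"]) simp
qed

end

section \<open>Novikov and bicommutative algebras\<close>

text \<open>
  Left symmetry makes both associators equal, and
  \<open>(a, z, b) = (a b) z - z (a b) + z (a b) - a (z b) = - [z, a b] + (z a) b - (a z) b\<close>.
\<close>

sublocale novikov_algebra \<subseteq> central_nuclear_algebra
proof
  show "(x \<cdot> y) \<cdot> z = (x \<cdot> z) \<cdot> y" for x y z
    by (rule right_commutative)
next
  fix J z a b
  assume J: "two_sided_ideal J" and z: "z \<in> central_modulo J"
  have "commutator z a \<cdot> b - commutator z (a \<cdot> b) \<in> J"
    by (intro subspace_diff[OF ideal_subspace[OF J]] ideal_mult_right[OF J] central_moduloD[OF z])
  also have "commutator z a \<cdot> b - commutator z (a \<cdot> b) = (a \<cdot> z) \<cdot> b - a \<cdot> (z \<cdot> b)"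
    using left_symmetric[of z a b] right_commutative[of a b z]
    by (simp add: commutator_def mult_linear algebra_simps)
  finally show mid: "(a \<cdot> z) \<cdot> b - a \<cdot> (z \<cdot> b) \<in> J" .
  then show "(z \<cdot> a) \<cdot> b - z \<cdot> (a \<cdot> b) \<in> J"
    using left_symmetric[of z a b] by simp
qed

text \<open>
  For central \<open>z\<close>, the outer terms of \<open>(z, a, b)\<close> agree by
  \<open>(z a) b = (z b) a = (b z) a = (b a) z = z (b a) = b (z a) = b (a z) = a (b z) = a (z b) = z (a b)\<close>;
  the displayed combination of commutators collects the errors of the steps that use centrality.
\<close>

sublocale bicommutative_algebra \<subseteq> central_nuclear_algebra
proof
  show "(x \<cdot> y) \<cdot> z = (x \<cdot> z) \<cdot> y" for x y z
    by (rule right_commutative)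
next
  fix J z a b
  assume J: "two_sided_ideal J" and z: "z \<in> central_modulo J"
  note sub = ideal_subspace[OF J]
  have "commutator z b \<cdot> a - commutator z (b \<cdot> a) + b \<cdot> commutator z a - a \<cdot> commutator z b \<in> J"
    by (intro subspace_diff[OF sub] subspace_add[OF sub] ideal_mult_right[OF J]
        ideal_mult_left[OF J] central_moduloD[OF z])
  also have "commutator z b \<cdot> a - commutator z (b \<cdot> a) + b \<cdot> commutator z a - a \<cdot> commutator z b
      = (z \<cdot> a) \<cdot> b - z \<cdot> (a \<cdot> b)"
    using right_commutative[of z a b] right_commutative[of b z a] left_commutative[of z b a]
      left_commutative[of b a z] left_commutative[of a z b]
    by (simp add: commutator_def mult_linear algebra_simps)
  finally show left: "(z \<cdot> a) \<cdot> b - z \<cdot> (a \<cdot> b) \<in> J" .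
  have "((z \<cdot> a) \<cdot> b - z \<cdot> (a \<cdot> b)) - commutator z a \<cdot> b \<in> J"
    by (intro subspace_diff[OF sub] left ideal_mult_right[OF J] central_moduloD[OF z])
  then show "(a \<cdot> z) \<cdot> b - a \<cdot> (z \<cdot> b) \<in> J"
    using left_commutative[of a z b] by (simp add: commutator_def mult_linear)
qed

theorem theorem3p4:
  fixes scale :: "'f::field \<Rightarrow> 'a::ab_group_add \<Rightarrow> 'a"
    and mult :: "'a \<Rightarrow> 'a \<Rightarrow> 'a"
  assumes "novikov_algebra scale mult \<or> bicommutative_algebra scale mult"
  shows "(nonassoc_algebra.lie_nilpotent scale mult \<longleftrightarrow> nonassoc_algebra.finite_class scale mult) \<and>
    (nonassoc_algebra.lie_nilpotent scale mult \<longrightarrow>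
       nonassoc_algebra.nilpotent_subspace scale mult
         (nonassoc_algebra.ideal_generated scale mult {mult a b - mult b a | a b. True}))"
proof -
  have "central_nuclear_algebra scale mult"
    using assms
  proof
    assume "novikov_algebra scale mult"
    then interpret novikov_algebra scale mult .
    show ?thesis by unfold_locales
  next
    assume "bicommutative_algebra scale mult"
    then interpret bicommutative_algebra scale mult .
    show ?thesis by unfold_locales
  qed
  then interpret central_nuclear_algebra scale mult .
  show ?thesis
    using finite_class_imp_lie_nilpotent lie_nilpotent_imp_finite_class
      lie_nilpotent_imp_commutator_ideal_nilpotent by blast
qed

end
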